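(* One-way permutations exist if and only if there exists a total one-one one-way function whose range is P-rankable.
   Context: $\Sigma=\{0,1\}$; $\le_{\mathrm{lex}}$ is the standard quasi-lexicographical (length-then-lexicographic) order on $\Sigma^\ast$. A function $f:\Sigma^\ast\to\Sigma^\ast$ is honest if there is a polynomial $p$ such that for every $y\in\mathrm{range}(f)$ and every $x$ with $f(x)=y$, $|x|\le p(|y|)$. $f$ is FP-invertible if there is a polynomial-time computable function $g$ such that for every $y\in\mathrm{range}(f)$, $g(y)$ is some element of $f^{-1}(y)$. A one-one one-way function is a function that is honest, injective, polynomial-time computable, and not FP-invertible. A one-way permutation is a total, surjective (range $\Sigma^\ast$), one-one one-way function $f:\Sigma^\ast\to\Sigma^\ast$. A set $A\subseteq\Sigma^\ast$ is P-rankable if there is a polynomial-time computable function $\mathrm{rank}$ with $\mathrm{rank}(x)=\|\{w\in A: w\le_{\mathrm{lex}} x\}\|$ for all $x\in\Sigma^\ast$. *)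

theory Defs
  imports
    "HOL-Computational_Algebra.Polynomial"
    "HOL-Library.List_Lenlexorder"
begin

text \<open>
  Strings over the alphabet \<open>{0,1}\<close> are boolean lists, with \<open>False\<close> for 0 and \<open>True\<close> for 1.
  The order \<open>\<le>\<close> on lists (from the theory \<open>List_Lenlexorder\<close>) is then the quasi-lexicographical
  one: shorter strings come first, strings of equal length are compared lexicographically.
  Possibly partial string functions are maps; \<open>dom f = UNIV\<close> says that \<open>f\<close> is total.
\<close>

type_synonym bitstring = "bool list"

datatype symbol = Blank | Bit bool | Work nat

datatype direction = Go_Left | Stay | Go_Right

text \<open>Deterministic Turing machines with one two-way infinite tape and an arbitrary finite
  tape alphabet.\<close>

record tm =
  states :: "nat set"
  alphabet :: "symbol set"
  start :: nat
  accept :: nat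
  reject :: nat
  delta :: "nat \<Rightarrow> symbol \<Rightarrow> nat \<times> symbol \<times> direction"

definition wf_tm :: "tm \<Rightarrow> bool" where
  "wf_tm M \<longleftrightarrow>
     finite (states M) \<and> finite (alphabet M) \<and>
     {Blank, Bit False, Bit True} \<subseteq> alphabet M \<and>
     {start M, accept M, reject M} \<subseteq> states M \<and> accept M \<noteq> reject M \<and>
     (\<forall>q \<in> states M - {accept M, reject M}. \<forall>s \<in> alphabet M.
        delta M q s \<in> states M \<times> alphabet M \<times> UNIV)"

text \<open>
  Tape cells are numbered relative to the head, which always scans cell 0; moving the head
  shifts the tape. A configuration is a state together with the tape contents.
\<close>

type_synonym tape = "int \<Rightarrow> symbol"

type_synonym config = "nat \<times> tape"

fun move :: "direction \<Rightarrow> tape \<Rightarrow> tape" where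
  "move Go_Left t = (\<lambda>i. t (i - 1))"
| "move Stay t = t"
| "move Go_Right t = (\<lambda>i. t (i + 1))"

definition step :: "tm \<Rightarrow> config \<Rightarrow> config" where
  "step M c = (case c of (q, t) \<Rightarrow>
     if q = accept M \<or> q = reject M then (q, t)
     else case delta M q (t 0) of (q', s, d) \<Rightarrow> (q', move d (t(0 := s))))"

text \<open>The tape holding \<open>x\<close>, blank elsewhere, with the head on the first symbol of \<open>x\<close>.\<close>

definition tape_of :: "bitstring \<Rightarrow> tape" where
  "tape_of x = (\<lambda>i. if 0 \<le> i \<and> i < int (length x) then Bit (x ! nat i) else Blank)"

text \<open>
  The machine halts on every input within a number of steps that is polynomial in the input
  length. It rejects the inputs outside the domain of \<open>f\<close>; on the others it accepts, leaving
  exactly the value of \<open>f\<close> on the tape, with the head on its first symbol.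
  Halting configurations are fixed points of \<open>step\<close>, so ``after exactly'' and ``within''
  the given number of steps mean the same.
\<close>

definition poly_time :: "(bitstring \<rightharpoonup> bitstring) \<Rightarrow> bool" where
  "poly_time f \<longleftrightarrow> (\<exists>M (p :: nat poly). wf_tm M \<and>
     (\<forall>x. let c = (step M ^^ poly p (length x)) (start M, tape_of x) in
        case f x of
          Some y \<Rightarrow> c = (accept M, tape_of y)
        | None \<Rightarrow> fst c = reject M))"

text \<open>The usual binary numeral of a number: most significant bit first, no leading zeros,
  and the numeral of 0 is the one-symbol string 0.\<close>

fun binary :: "nat \<Rightarrow> bitstring" where
  "binary n = (if n < 2 then [n = 1] else binary (n div 2) @ [odd n])"

declare binary.simps [simp del]

definition honest :: "(bitstring \<rightharpoonup> bitstring) \<Rightarrow> bool" where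
  "honest f \<longleftrightarrow> (\<exists>p :: nat poly. \<forall>y \<in> ran f. \<forall>x. f x = Some y \<longrightarrow> length x \<le> poly p (length y))"

definition FP_invertible :: "(bitstring \<rightharpoonup> bitstring) \<Rightarrow> bool" where
  "FP_invertible f \<longleftrightarrow>
     (\<exists>g. poly_time g \<and> (\<forall>y \<in> ran f. \<exists>x. g y = Some x \<and> f x = Some y))"

definition one_one_one_way :: "(bitstring \<rightharpoonup> bitstring) \<Rightarrow> bool" where
  "one_one_one_way f \<longleftrightarrow> honest f \<and> inj_on f (dom f) \<and> poly_time f \<and> \<not> FP_invertible f"

definition one_way_permutation :: "(bitstring \<rightharpoonup> bitstring) \<Rightarrow> bool" where
  "one_way_permutation f \<longleftrightarrow> dom f = UNIV \<and> ran f = UNIV \<and> one_one_one_way f"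

definition P_rankable :: "bitstring set \<Rightarrow> bool" where
  "P_rankable A \<longleftrightarrow> (\<exists>rank :: bitstring \<Rightarrow> nat.
     poly_time (\<lambda>x. Some (binary (rank x))) \<and> (\<forall>x. rank x = card {w \<in> A. w \<le> x}))"

end

theory Submission
  imports Defs
begin

text \<open>
  The rank of \<open>x\<close> in the set of all strings has the binary numeral \<open>1x\<close>, so the range of a
  permutation is P-rankable. Conversely, if \<open>A = ran f\<close> is P-rankable, then sending \<open>y\<close> to the
  binary numeral of its rank in \<open>A\<close> without the leading 1 is a polynomial-time bijection from
  \<open>A\<close> onto all strings; composing it with \<open>f\<close> gives a permutation \<open>h\<close>, and an inverter of \<open>h\<close>
  yields one of \<open>f\<close>. The only delicate point is honesty of \<open>h\<close>, as ranks in a sparse set are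
  small: since \<open>f\<close> is injective and \<open>|f w| \<le> q |w|\<close>, a value \<open>f x\<close> longer than \<open>q n\<close> lies above the
  \<open>2 ^ n\<close> values of \<open>f\<close> at strings of length \<open>n\<close>, so its rank is at least \<open>2 ^ n\<close>.
\<close>

section \<open>Ranks in the quasi-lexicographical order\<close>

lemma length_le_if_le: "w \<le> x \<Longrightarrow> length w \<le> length x" for w x :: bitstring
  by (auto simp: list_le_def list_less_def lenlex_conv)

lemma less_if_length_less: "length w < length x \<Longrightarrow> w < x" for w x :: bitstring
  by (auto simp: list_less_def lenlex_conv)

lemma finite_atMost_bitstring [simp]: "finite {w. w \<le> (x :: bitstring)}"
proof (rule finite_subset)
  show "{w. w \<le> x} \<subseteq> {w. set w \<subseteq> UNIV \<and> length w \<le> length x}"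
    using length_le_if_le by auto
qed (rule finite_lists_length_le, simp)

lemma finite_atMost_bitstring_Int [simp]: "finite {w \<in> A. w \<le> (x :: bitstring)}"
  by (rule finite_subset[OF _ finite_atMost_bitstring[of x]]) auto

text \<open>\<open>lex\<close> recurses on the first symbol, whereas numerals and ranks are built up
  at the last one; between strings of equal length the comparison can be peeled off at that end
  too.\<close>

lemma lex_append_singleton:
  assumes "length u = length v"
  shows "(u @ [a], v @ [b]) \<in> lex r \<longleftrightarrow> (u, v) \<in> lex r \<or> u = v \<and> (a, b) \<in> r"
  using assms by (induction u v rule: list_induct2) auto

lemma append_bit_le_iff:
  fixes u v :: bitstring
  shows "u @ [a] \<le> v @ [b] \<longleftrightarrow> u < v \<or> u = v \<and> a \<le> b"
  by (cases "length u = length v")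
     (auto simp: list_le_def list_less_def lenlex_conv lex_append_singleton)

text \<open>Apart from the empty string, the strings up to \<open>z @ [b]\<close> are all
  \<open>v @ [c]\<close> with \<open>v < z\<close>, two for each \<open>v\<close>, and the
  \<open>z @ [c]\<close> with \<open>c \<le> b\<close>. With \<open>l\<close> strings strictly below
  \<open>z\<close> this makes \<open>1 + 2 * l + 1 + of_bool b\<close>, and \<open>l + 1\<close> is
  the rank of \<open>z\<close>.\<close>

lemma card_atMost_append_bit:
  fixes z :: bitstring
  shows "card {w. w \<le> z @ [b]} = 2 * card {w. w \<le> z} + of_bool b"
proof -
  let ?L = "{v. v < z}"
  have L: "finite ?L"
    by (rule finite_subset[OF _ finite_atMost_bitstring[of z]]) auto
  have "{w. w \<le> z} = insert z ?L"
    by auto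
  then have z: "card {w. w \<le> z} = Suc (card ?L)"
    using L by simp
  let ?f = "\<lambda>(v :: bitstring, c). v @ [c]" and ?B = "?L \<times> UNIV \<union> {z} \<times> {c. c \<le> b}"
  have inj: "inj ?f"
    by (auto simp: inj_def)
  have split: "{w. w \<le> z @ [b]} = insert [] (?f ` ?B)"
  proof (rule set_eqI)
    fix w :: bitstring
    show "w \<in> {w. w \<le> z @ [b]} \<longleftrightarrow> w \<in> insert [] (?f ` ?B)"
    proof (cases w rule: rev_cases)
      case (snoc v c)
      have "v @ [c] \<in> ?f ` ?B \<longleftrightarrow> (v, c) \<in> ?B"
        using inj_image_mem_iff[OF inj, of "(v, c)" ?B] by (simp only: prod.case)
      also have "\<dots> \<longleftrightarrow> v @ [c] \<le> z @ [b]"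
        unfolding append_bit_le_iff by blast
      finally show ?thesis
        unfolding snoc by simp
    qed simp
  qed
  have "card (?f ` ?B) = card ?B"
    using inj by (rule card_image[OF inj_on_subset]) simp
  also have "\<dots> = card ?L * 2 + card {c. c \<le> b}"
    using L by (subst card_Un_disjoint) (auto simp: card_cartesian_product)
  also have "card {c. c \<le> b} = Suc (of_bool b)"
  proof -
    have "{c. c \<le> b} = (if b then {False, True} else {False})"
      by auto
    then show ?thesis
      by simp
  qed
  finally have "card (?f ` ?B) = card ?L * 2 + Suc (of_bool b)" .
  moreover have "card {w. w \<le> z @ [b]} = Suc (card (?f ` ?B))"
    unfolding split using L by (intro card_insert_disjoint) auto
  ultimately show ?thesis
    using z by simp
qed

section \<open>Binary numerals\<close>

lemma binary_double: "0 < n \<Longrightarrow> binary (2 * n + of_bool b) = binary n @ [b]"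
  by (subst binary.simps) auto

text \<open>Appending a bit acts on ranks as it does on numerals. The empty string has rank 1, and
  this is where the leading \<open>True\<close> comes from.\<close>

lemma binary_card_atMost: "binary (card {w. w \<le> x}) = True # x"
proof (induction x rule: rev_induct)
  case Nil
  have "{w. w \<le> ([] :: bitstring)} = {[]}"
    by auto
  then show ?case
    by (simp add: binary.simps)
next
  case (snoc b z)
  have "0 < card {w. w \<le> z}"
    by (auto simp: card_gt_0_iff)
  then show ?case
    by (simp add: card_atMost_append_bit binary_double snoc)
qed

text \<open>Ensures that \<open>tl\<close> removes the same symbol from the numeral of every
  positive rank, so that no information is lost.\<close>

lemma hd_binary: "0 < n \<Longrightarrow> \<exists>x. binary n = True # x"
proof (induction n rule: binary.induct)
  case (1 n)
  then show ?case
    by (cases "n < 2") (auto simp: binary.simps[of n])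
qed

text \<open>Horner evaluation is a left inverse of \<open>binary\<close>, whence
  injectivity.\<close>

lemma foldl_binary: "foldl (\<lambda>a b. 2 * a + of_bool b) 0 (binary n) = n"
proof (induction n rule: binary.induct)
  case (1 n)
  then show ?case
    by (cases "n < 2") (auto simp: binary.simps[of n])
qed

lemma inj_binary: "inj binary"
  by (metis foldl_binary injI)

lemma less_power_length_binary: "n < 2 ^ length (binary n)"
proof (induction n rule: binary.induct)
  case (1 n)
  then show ?case
    by (cases "n < 2") (auto simp: binary.simps[of n])
qed

section \<open>Ranks within a set of strings\<close>

lemma card_below_less:
  fixes x y :: bitstring
  assumes "y \<in> A" "x < y"
  shows "card {w \<in> A. w \<le> x} < card {w \<in> A. w \<le> y}"
proof (rule psubset_card_mono[OF finite_atMost_bitstring_Int])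
  have "{w \<in> A. w \<le> x} \<subseteq> {w \<in> A. w \<le> y}"
    using order_trans[OF _ less_imp_le[OF assms(2)]] by blast
  moreover have "y \<in> {w \<in> A. w \<le> y}" "y \<notin> {w \<in> A. w \<le> x}"
    using assms by auto
  ultimately show "{w \<in> A. w \<le> x} \<subset> {w \<in> A. w \<le> y}"
    by blast
qed

lemma card_below_inj:
  fixes x y :: bitstring
  assumes "x \<in> A" "y \<in> A" "card {w \<in> A. w \<le> x} = card {w \<in> A. w \<le> y}"
  shows "x = y"
  using card_below_less[OF assms(1), of y] card_below_less[OF assms(2), of x] assms(3)
  by (cases x y rule: linorder_cases) simp_all

lemma card_below_pos: "x \<in> A \<Longrightarrow> 0 < card {w \<in> A. w \<le> (x :: bitstring)}"
  by (auto simp: card_gt_0_iff)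

text \<open>Take \<open>x\<close> in \<open>A\<close> of least rank above \<open>m\<close>. All
  elements of \<open>A\<close> below \<open>x\<close> have rank at most \<open>m\<close>; the
  greatest of them, if any, has all of them counted in its rank, so there are at most
  \<open>m\<close>. Counting \<open>x\<close> as well, its rank is exactly
  \<open>Suc m\<close>.\<close>

lemma card_below_surj:
  fixes A :: "bitstring set"
  assumes "infinite A"
  shows "\<exists>x \<in> A. card {w \<in> A. w \<le> x} = Suc m"
proof -
  let ?r = "\<lambda>x. card {w \<in> A. w \<le> x}"
  \<comment> \<open>Injectivity on an infinite set makes the ranks unbounded, so some rank exceeds
    \<open>m\<close>.\<close>
  have "inj_on ?r A"
    by (rule inj_onI) (rule card_below_inj)
  with assms have "infinite (?r ` A)"
    using finite_imageD by blast
  then have "\<exists>x. x \<in> A \<and> m < ?r x"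
    by (auto simp: infinite_nat_iff_unbounded)
  then obtain x where x: "x \<in> A" "m < ?r x" and min: "\<And>z. z \<in> A \<and> m < ?r z \<Longrightarrow> ?r x \<le> ?r z"
    using ex_has_least_nat[of "\<lambda>x. x \<in> A \<and> m < ?r x" _ ?r] by blast
  have least: "?r z \<le> m" if "z \<in> A" "z < x" for z
    using min[of z] card_below_less[OF x(1) that(2)] that(1) by linarith
  let ?L = "{w \<in> A. w < x}"
  have fin: "finite ?L"
    by (rule finite_subset[OF _ finite_atMost_bitstring[of x]]) auto
  have "card ?L \<le> m"
  proof (cases "?L = {}")
    case False
    define z where "z = Max ?L"
    have "z \<in> ?L"
      unfolding z_def using fin False by (rule Max_in)
    then have "?L = {w \<in> A. w \<le> z}"
      using fin by (auto simp: z_def)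
    moreover have "?r z \<le> m"
      using least \<open>z \<in> ?L\<close> by blast
    ultimately show ?thesis
      by simp
  next
    case True
    show ?thesis
      unfolding True by simp
  qed
  moreover have "{w \<in> A. w \<le> x} = insert x ?L"
    using x by auto
  then have "?r x = Suc (card ?L)"
    using fin by simp
  ultimately show ?thesis
    using x by (intro bexI[of _ x]) auto
qed

section \<open>Polynomial-time functions\<close>

text \<open>Monotone because the coefficients are natural numbers; this allows bounds on lengths to
  be substituted into running times.\<close>

lemma poly_nat_mono: "m \<le> n \<Longrightarrow> poly p m \<le> poly p n" for p :: "nat poly"
  by (induction p) (auto intro: add_mono mult_mono)

lemma step_halted: "fst c = accept M \<or> fst c = reject M \<Longrightarrow> step M c = c"
  by (auto simp: step_def split: prod.splits)

text \<open>Stretches a run that has halted early to the number of steps that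
  \<open>poly_time\<close> prescribes.\<close>

lemma steps_halted:
  assumes "m \<le> n" "fst ((step M ^^ m) c) = accept M \<or> fst ((step M ^^ m) c) = reject M"
  shows "(step M ^^ n) c = (step M ^^ m) c"
  using assms(1)
proof (induction n rule: dec_induct)
  case (step n)
  then show ?case
    using step_halted[OF assms(2)] by simp
qed simp

lemma poly_time_iff:
  "poly_time f \<longleftrightarrow> (\<exists>M (p :: nat poly). wf_tm M \<and>
     (\<forall>x. f x = None \<longrightarrow> fst ((step M ^^ poly p (length x)) (start M, tape_of x)) = reject M) \<and>
     (\<forall>x y. f x = Some y \<longrightarrow>
        (step M ^^ poly p (length x)) (start M, tape_of x) = (accept M, tape_of y)))"
  unfolding poly_time_def Let_def option.split[where P = "\<lambda>b. b"] all_conj_distrib ..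

text \<open>A step adds at most one non-blank cell.\<close>

lemma poly_time_length_bound:
  assumes "poly_time f"
  obtains p :: "nat poly" where "\<And>x y. f x = Some y \<Longrightarrow> length y \<le> poly p (length x)"
proof -
  from assms obtain M p where M: "\<And>x y. f x = Some y \<Longrightarrow>
      (step M ^^ poly p (length x)) (start M, tape_of x) = (accept M, tape_of y)"
    unfolding poly_time_iff by blast
  define supp where "supp t = {i. t i \<noteq> Blank}" for t :: tape
  \<comment> \<open>A head move only translates the tape and keeps the number of non-blank cells;
    only the write can add one.\<close>
  have supp_move: "supp (move d t) = (\<lambda>i. case d of Go_Left \<Rightarrow> i + 1 | Stay \<Rightarrow> i | Go_Right \<Rightarrow> i - 1) ` supp t"
    for d t
    by (cases d) (force simp: supp_def image_iff)+
  have step: "finite (supp (snd (step M c))) \<and> card (supp (snd (step M c))) \<le> Suc (card (supp (snd c)))"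
    if fin: "finite (supp (snd c))" for c
  proof -
    have upd: "supp ((snd c)(0 := s)) \<subseteq> insert 0 (supp (snd c))" for s
      by (auto simp: supp_def)
    have "finite (supp (move d ((snd c)(0 := s)))) \<and>
        card (supp (move d ((snd c)(0 := s)))) \<le> Suc (card (supp (snd c)))" for d s
    proof -
      have f: "finite (supp ((snd c)(0 := s)))"
        using upd fin finite_subset by blast
      have "card (supp (move d ((snd c)(0 := s)))) \<le> card (supp ((snd c)(0 := s)))"
        unfolding supp_move by (rule card_image_le[OF f])
      also have "\<dots> \<le> card (insert 0 (supp (snd c)))"
        using fin upd by (intro card_mono) auto
      also have "\<dots> \<le> Suc (card (supp (snd c)))"
        by (rule card_insert_le_m1) auto
      finally show ?thesis
        using f by (simp add: supp_move)
    qed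
    with fin show ?thesis
      by (auto simp: step_def split: prod.splits)
  qed
  have supp_tape: "supp (tape_of x) = {0..<int (length x)}" for x
    by (auto simp: supp_def tape_of_def)
  have steps: "finite (supp (snd ((step M ^^ n) c))) \<and>
      card (supp (snd ((step M ^^ n) c))) \<le> n + card (supp (snd c))"
    if "finite (supp (snd c))" for c n
  proof (induction n)
    case (Suc n)
    then show ?case
      using step[of "(step M ^^ n) c"] by auto
  qed (use that in auto)
  show thesis
  \<comment> \<open>The identity polynomial \<open>[:0, 1:]\<close> accounts for the
    \<open>length x\<close> cells that are non-blank at the start; the final tape has exactly
    \<open>length y\<close> of them.\<close>
  proof (rule that[of "p + [:0, 1:]"])
    fix x y
    assume "f x = Some y"
    from steps[of "(start M, tape_of x)" "poly p (length x)"]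
    show "length y \<le> poly (p + [:0, 1:]) (length x)"
      unfolding M[OF \<open>f x = Some y\<close>] by (simp add: supp_tape)
  qed
qed

section \<open>Sequential composition of Turing machines\<close>

text \<open>The states of the first machine become even, those of the second odd, and the halting
  states of the first are identified with the start and the rejecting state of the second.\<close>

definition seq_fst :: "tm \<Rightarrow> tm \<Rightarrow> nat \<Rightarrow> nat" where
  "seq_fst M N q = (if q = accept M then Suc (2 * start N)
     else if q = reject M then Suc (2 * reject N) else 2 * q)"

text \<open>The alphabets may differ, and well-formedness says nothing about \<open>delta\<close> on
  foreign symbols. The guards on \<open>s\<close> send such cases to the rejecting state, which
  keeps the combined machine well-formed.\<close>

definition seq_tm :: "tm \<Rightarrow> tm \<Rightarrow> tm" where
  "seq_tm M N =
    \<lparr>states = seq_fst M N ` states M \<union> (\<lambda>q. Suc (2 * q)) ` states N,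
     alphabet = alphabet M \<union> alphabet N,
     start = seq_fst M N (start M),
     accept = Suc (2 * accept N),
     reject = Suc (2 * reject N),
     delta = (\<lambda>q s.
       if even q \<and> s \<in> alphabet M then apfst (seq_fst M N) (delta M (q div 2) s)
       else if odd q \<and> s \<in> alphabet N then apfst (\<lambda>q. Suc (2 * q)) (delta N (q div 2) s)
       else (Suc (2 * reject N), s, Stay))\<rparr>"

lemma wf_delta:
  assumes "wf_tm M" "q \<in> states M" "q \<noteq> accept M" "q \<noteq> reject M" "s \<in> alphabet M"
    "delta M q s = (q', s', d)"
  shows "q' \<in> states M" "s' \<in> alphabet M"
proof -
  from assms have "delta M q s \<in> states M \<times> alphabet M \<times> UNIV"
    unfolding wf_tm_def by blast
  then show "q' \<in> states M" "s' \<in> alphabet M"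
    using assms by auto
qed

lemma wf_seq_tm:
  assumes M: "wf_tm M" and N: "wf_tm N"
  shows "wf_tm (seq_tm M N)"
proof -
  let ?S = "seq_tm M N"
  have "delta ?S q s \<in> states ?S \<times> alphabet ?S \<times> UNIV"
    if q: "q \<in> states ?S - {accept ?S, reject ?S}" and s: "s \<in> alphabet ?S" for q s
  proof -
    have r: "Suc (2 * reject N) \<in> states ?S"
      using N by (auto simp: seq_tm_def wf_tm_def)
    \<comment> \<open>Halting states of \<open>M\<close> are relabelled as odd states: the accepting
      one falls under the second case as \<open>start N\<close> unless it is halting there, the
      rejecting one is excluded as \<open>reject ?S\<close>.\<close>
    consider
      (fst) q0 where "q0 \<in> states M" "q0 \<noteq> accept M" "q0 \<noteq> reject M" "q = 2 * q0"
      | (snd) q0 where "q0 \<in> states N" "q0 \<noteq> accept N" "q0 \<noteq> reject N" "q = Suc (2 * q0)"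
    proof -
      have "start N \<in> states N"
        using N by (auto simp: wf_tm_def)
      with q that show thesis
        by (auto simp: seq_tm_def seq_fst_def split: if_splits)
    qed
    then show ?thesis
    proof cases
      case fst
      obtain q' s' d where "delta M q0 s = (q', s', d)"
        by (cases "delta M q0 s") auto
      with wf_delta[OF M fst(1-3) _ this] fst(4) s r show ?thesis
        by (auto simp: seq_tm_def)
    next
      case snd
      obtain q' s' d where "delta N q0 s = (q', s', d)"
        by (cases "delta N q0 s") auto
      with wf_delta[OF N snd(1-3) _ this] snd(4) s r show ?thesis
        by (auto simp: seq_tm_def)
    qed
  qed
  with assms show ?thesis
    by (auto simp: wf_tm_def[of M] wf_tm_def[of N]) (auto simp: wf_tm_def seq_tm_def)
qed

text \<open>The invariant under which the alphabet guards of \<open>seq_tm\<close> never force a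
  rejection.\<close>

definition wf_config :: "tm \<Rightarrow> config \<Rightarrow> bool" where
  "wf_config M c \<longleftrightarrow> fst c \<in> states M \<and> range (snd c) \<subseteq> alphabet M"

lemma wf_config_initial: "wf_tm M \<Longrightarrow> wf_config M (start M, tape_of x)"
  by (auto simp: wf_tm_def wf_config_def tape_of_def) (metis (full_types))

lemma wf_config_step:
  assumes "wf_tm M" "wf_config M c"
  shows "wf_config M (step M c)"
proof (cases "fst c = accept M \<or> fst c = reject M")
  case True
  with assms show ?thesis
    by (simp add: step_halted)
next
  case False
  obtain q t where c: "c = (q, t)"
    by (cases c)
  obtain q' s' d where d: "delta M q (t 0) = (q', s', d)"
    by (cases "delta M q (t 0)") auto
  have "q' \<in> states M" "s' \<in> alphabet M"
    using wf_delta[OF assms(1) _ _ _ _ d] False assms(2) by (auto simp: c wf_config_def)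
  have "range (move d (t(0 := s'))) \<subseteq> insert s' (range t)"
    by (cases d) auto
  also have "\<dots> \<subseteq> alphabet M"
    using \<open>s' \<in> alphabet M\<close> assms(2) by (simp add: c wf_config_def)
  finally have "range (move d (t(0 := s'))) \<subseteq> alphabet M" .
  with \<open>q' \<in> states M\<close> False show ?thesis
    by (simp add: c d step_def wf_config_def)
qed

lemma wf_config_steps: "wf_tm M \<Longrightarrow> wf_config M c \<Longrightarrow> wf_config M ((step M ^^ n) c)"
  by (induction n) (auto simp: wf_config_step)

text \<open>Halting states are excluded since an accepting configuration of \<open>M\<close> is
  fixed by \<open>M\<close>, while its image may go on running as \<open>N\<close>.\<close>

lemma step_seq_tm_fst:
  assumes "wf_config M c" "fst c \<noteq> accept M" "fst c \<noteq> reject M"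
  shows "step (seq_tm M N) (apfst (seq_fst M N) c) = apfst (seq_fst M N) (step M c)"
proof -
  obtain q t where c: "c = (q, t)"
    by (cases c)
  have "seq_fst M N q = 2 * q"
    using assms by (simp add: c seq_fst_def)
  moreover have "t 0 \<in> alphabet M"
    using assms by (auto simp: c wf_config_def)
  moreover have "2 * q \<noteq> Suc (2 * k)" for k
    by presburger
  ultimately show ?thesis
    using assms unfolding c by (auto simp: step_def seq_tm_def split: prod.splits)
qed

lemma step_seq_tm_snd:
  assumes "wf_config N c"
  shows "step (seq_tm M N) (apfst (\<lambda>q. Suc (2 * q)) c) = apfst (\<lambda>q. Suc (2 * q)) (step N c)"
proof -
  obtain q t where c: "c = (q, t)"
    by (cases c)
  have "t 0 \<in> alphabet N"
    using assms by (auto simp: c wf_config_def)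
  then show ?thesis
    unfolding c by (auto simp: step_def seq_tm_def split: prod.splits)
qed

text \<open>The count \<open>k\<close> stops growing once \<open>M\<close> has halted: idle steps of
  \<open>M\<close> must not be simulated, as the combined machine would already be running
  \<open>N\<close>.\<close>

lemma steps_seq_tm_fst:
  assumes "wf_tm M" "wf_config M c"
  shows "\<exists>k \<le> n. (step (seq_tm M N) ^^ k) (apfst (seq_fst M N) c) = apfst (seq_fst M N) ((step M ^^ n) c)"
proof (induction n)
  case (Suc n)
  then obtain k where k: "k \<le> n"
    "(step (seq_tm M N) ^^ k) (apfst (seq_fst M N) c) = apfst (seq_fst M N) ((step M ^^ n) c)"
    by blast
  let ?c = "(step M ^^ n) c"
  show ?case
  proof (cases "fst ?c = accept M \<or> fst ?c = reject M")
    case True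
    with k show ?thesis
      by (intro exI[of _ k]) (auto simp: step_halted)
  next
    case False
    with k step_seq_tm_fst[OF wf_config_steps[OF assms]] show ?thesis
      by (intro exI[of _ "Suc k"]) auto
  qed
qed auto

lemma steps_seq_tm_snd:
  assumes "wf_tm N" "wf_config N c"
  shows "(step (seq_tm M N) ^^ n) (apfst (\<lambda>q. Suc (2 * q)) c) = apfst (\<lambda>q. Suc (2 * q)) ((step N ^^ n) c)"
  by (induction n) (auto simp: step_seq_tm_snd wf_config_steps assms)

lemma poly_time_map_comp:
  assumes f: "poly_time f" and g: "poly_time g"
  shows "poly_time (g \<circ>\<^sub>m f)"
proof -
  from f obtain M p where M: "wf_tm M" and
    run_M_None: "\<And>x. f x = None \<Longrightarrow>
      fst ((step M ^^ poly p (length x)) (start M, tape_of x)) = reject M" and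
    run_M: "\<And>x y. f x = Some y \<Longrightarrow>
      (step M ^^ poly p (length x)) (start M, tape_of x) = (accept M, tape_of y)"
    unfolding poly_time_iff by blast
  from g obtain N q where N: "wf_tm N" and
    run_N_None: "\<And>x. g x = None \<Longrightarrow>
      fst ((step N ^^ poly q (length x)) (start N, tape_of x)) = reject N" and
    run_N: "\<And>x y. g x = Some y \<Longrightarrow>
      (step N ^^ poly q (length x)) (start N, tape_of x) = (accept N, tape_of y)"
    unfolding poly_time_iff by blast
  from f obtain b :: "nat poly" where b: "\<And>x y. f x = Some y \<Longrightarrow> length y \<le> poly b (length x)"
    by (rule poly_time_length_bound) (rule that)
  \<comment> \<open>\<open>N\<close> runs on an output of \<open>M\<close>, whose length is bounded
    by \<open>b\<close>; hence the time \<open>q\<close> is taken at \<open>b\<close>.\<close>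
  let ?S = "seq_tm M N" and ?r = "p + pcompose q b"
  have "accept M \<noteq> reject M"
    using M by (simp add: wf_tm_def)
  have run: "((g \<circ>\<^sub>m f) x = None \<longrightarrow>
        fst ((step ?S ^^ poly ?r (length x)) (start ?S, tape_of x)) = reject ?S) \<and>
      (\<forall>y. (g \<circ>\<^sub>m f) x = Some y \<longrightarrow>
        (step ?S ^^ poly ?r (length x)) (start ?S, tape_of x) = (accept ?S, tape_of y))" for x
  proof -
    let ?c = "(step M ^^ poly p (length x)) (start M, tape_of x)"
    have "apfst (seq_fst M N) (start M, tape_of x) = (start ?S, tape_of x)"
      by (simp add: seq_tm_def)
    then obtain k where k: "k \<le> poly p (length x)"
      "(step ?S ^^ k) (start ?S, tape_of x) = apfst (seq_fst M N) ?c"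
      using steps_seq_tm_fst[OF M wf_config_initial[OF M]] by metis
    show ?thesis
    proof (cases "f x")
      case None
      then have "fst ?c = reject M"
        by (rule run_M_None)
      then have reject: "fst ((step ?S ^^ k) (start ?S, tape_of x)) = reject ?S"
        using \<open>accept M \<noteq> reject M\<close> unfolding k(2) by (simp add: seq_fst_def seq_tm_def)
      moreover have "k \<le> poly ?r (length x)"
        using k(1) by simp
      ultimately have "(step ?S ^^ poly ?r (length x)) (start ?S, tape_of x) =
          (step ?S ^^ k) (start ?S, tape_of x)"
        by (intro steps_halted) auto
      with reject None show ?thesis
        by simp
    next
      case (Some y)
      let ?m = "poly q (length y) + k" and ?d = "(step N ^^ poly q (length y)) (start N, tape_of y)"
      from Some have "?c = (accept M, tape_of y)"
        by (rule run_M)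
      \<comment> \<open>\<open>M\<close> leaves exactly \<open>tape_of y\<close> with the head on
        its first symbol, and its accepting state becomes \<open>start N\<close>: this is an initial
        configuration of \<open>N\<close>.\<close>
      then have "(step ?S ^^ k) (start ?S, tape_of x) = apfst (\<lambda>q. Suc (2 * q)) (start N, tape_of y)"
        unfolding k(2) by (simp add: seq_fst_def)
      then have m: "(step ?S ^^ ?m) (start ?S, tape_of x) = apfst (\<lambda>q. Suc (2 * q)) ?d"
        unfolding funpow_add o_apply
        by (simp only: steps_seq_tm_snd[OF N wf_config_initial[OF N]])
      have halted: "fst ?d = accept N \<or> fst ?d = reject N"
        using run_N[of y] run_N_None[of y] by (cases "g y") auto
      have "?m \<le> poly ?r (length x)"
        using k(1) poly_nat_mono[OF b[OF Some], of q] unfolding poly_add poly_pcompose by linarith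
      then have "(step ?S ^^ poly ?r (length x)) (start ?S, tape_of x) =
          (step ?S ^^ ?m) (start ?S, tape_of x)"
        by (rule steps_halted) (use halted in \<open>unfold m, auto simp: seq_tm_def\<close>)
      also note m
      finally have final: "(step ?S ^^ poly ?r (length x)) (start ?S, tape_of x) =
          apfst (\<lambda>q. Suc (2 * q)) ?d" .
      show ?thesis
        unfolding final using run_N[of y] run_N_None[of y] Some
        by (cases "g y") (auto simp: seq_tm_def)
    qed
  qed
  with wf_seq_tm[OF M N] show ?thesis
    unfolding poly_time_iff by (intro exI[of _ ?S] exI[of _ ?r]) simp
qed

lemma poly_time_Cons: "poly_time (\<lambda>x. Some (b # x))"
proof -
  \<comment> \<open>Two steps: move to the blank cell left of the input, then write \<open>b\<close>
    there.\<close>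
  let ?M = "\<lparr>states = {0, 1, 2, 3}, alphabet = {Blank, Bit False, Bit True}, start = 0,
    accept = 2, reject = 3,
    delta = (\<lambda>q s. if q = 0 then (1, s, Go_Left) else (2, Bit b, Stay))\<rparr>"
  have "wf_tm ?M"
    by (auto simp: wf_tm_def)
  moreover have "(step ?M ^^ poly [:2:] (length x)) (start ?M, tape_of x) = (accept ?M, tape_of (b # x))" for x
    by (auto simp: numeral_2_eq_2 step_def tape_of_def fun_eq_iff nth_Cons' nat_diff_distrib)
  ultimately show ?thesis
    unfolding poly_time_def Let_def option.case by (intro exI conjI allI)
qed

lemma poly_time_tl: "poly_time (\<lambda>x. Some (tl x))"
proof -
  \<comment> \<open>One step erases the first symbol and moves past it; the empty input stays empty,
    in agreement with \<open>tl []\<close>.\<close>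
  let ?M = "\<lparr>states = {0, 1, 2}, alphabet = {Blank, Bit False, Bit True}, start = 0,
    accept = 1, reject = 2, delta = (\<lambda>q s. (1, Blank, Go_Right))\<rparr>"
  have "wf_tm ?M"
    by (auto simp: wf_tm_def)
  moreover have "(step ?M ^^ poly [:1:] (length x)) (start ?M, tape_of x) = (accept ?M, tape_of (tl x))" for x
    by (cases x) (auto simp: step_def tape_of_def fun_eq_iff nth_Cons' nat_diff_distrib nat_add_distrib)
  ultimately show ?thesis
    unfolding poly_time_def Let_def option.case by (intro exI conjI allI)
qed

section \<open>Compressing a rankable range\<close>

lemma P_rankable_UNIV: "P_rankable UNIV"
  unfolding P_rankable_def
  by (rule exI[of _ "\<lambda>x. card {w. w \<le> x}"]) (simp add: binary_card_atMost poly_time_Cons)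

lemma one_way_permutation_if_rankable:
  assumes f: "one_one_one_way f" and total: "dom f = UNIV" and rankable: "P_rankable (ran f)"
  shows "\<exists>h. one_way_permutation h"
proof -
  let ?A = "ran f"
  define rank where "rank x = card {w \<in> ?A. w \<le> x}" for x
  \<comment> \<open>Outside \<open>?A\<close> the rank can be 0, and \<open>c\<close> then yields
    the empty string; only the values on \<open>?A\<close> matter.\<close>
  define c where "c y = tl (binary (rank y))" for y
  have "poly_time (\<lambda>x. Some (binary (rank x)))"
    using rankable unfolding P_rankable_def rank_def by (elim exE conjE) simp
  from poly_time_map_comp[OF this poly_time_tl] have time_c: "poly_time (Some \<circ> c)"
    by (simp add: map_comp_def c_def o_def)
  obtain F where F: "f = (\<lambda>x. Some (F x))"
  proof
    show "f = (\<lambda>x. Some (the (f x)))"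
    proof
      fix x
      have "x \<in> dom f"
        by (simp add: total)
      then show "f x = Some (the (f x))"
        by auto
    qed
  qed
  have A: "?A = range F"
    by (auto simp: F ran_def)
  have inj: "inj F"
    using f by (auto simp: one_one_one_way_def F inj_on_def)
  have time_f: "poly_time f"
    using f by (simp add: one_one_one_way_def)
  have binary_rank: "binary (rank y) = True # c y" if "y \<in> ?A" for y
    using hd_binary[OF card_below_pos[OF that]] by (auto simp: c_def rank_def)
  have inj_c: "y = z" if "y \<in> ?A" "z \<in> ?A" "c y = c z" for y z
  proof -
    have "binary (rank y) = binary (rank z)"
      using that by (simp add: binary_rank)
    then have "rank y = rank z"
      by (rule injD[OF inj_binary])
    then show ?thesis
      unfolding rank_def by (rule card_below_inj[OF that(1,2)])
  qed
  define h where "h = (\<lambda>x. Some (c (F x)))"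
  have "ran h = UNIV"
  proof -
    have "y \<in> ran h" for y
    proof -
      have "infinite ?A"
        unfolding A using infinite_UNIV_listI inj by (simp add: finite_image_iff)
      \<comment> \<open>The preimage of \<open>y\<close> under \<open>c\<close> is the element of
        \<open>?A\<close> whose rank equals the rank of \<open>y\<close> among all strings, because
        the numeral of that number is 1 followed by \<open>y\<close>.\<close>
      moreover have "card {w. w \<le> y} = Suc (card {w. w \<le> y} - 1)"
        using card_below_pos[of y UNIV] by simp
      ultimately obtain z where z: "z \<in> ?A" "rank z = card {w. w \<le> y}"
        unfolding rank_def using card_below_surj[of ?A "card {w. w \<le> y} - 1"] by auto
      then have "c z = y"
        by (simp add: c_def binary_card_atMost)
      moreover obtain x where "z = F x"
        using z(1) unfolding A by blast
      ultimately have "h x = Some y"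
        by (simp add: h_def)
      then show ?thesis
        by (rule ranI)
    qed
    then show ?thesis
      by blast
  qed
  moreover have "poly_time h"
    using poly_time_map_comp[OF time_f time_c] by (simp add: map_comp_def h_def F)
  moreover have "inj_on h (dom h)"
  proof (rule inj_onI)
    fix x y
    assume "h x = h y"
    then have "c (F x) = c (F y)"
      by (simp add: h_def)
    then have "F x = F y"
      using inj_c[of "F x" "F y"] by (simp add: A)
    then show "x = y"
      by (rule injD[OF inj])
  qed
  moreover have "honest h"
  proof -
    have "honest f"
      using f by (simp add: one_one_one_way_def)
    then obtain p :: "nat poly" where
      "\<forall>y \<in> ran f. \<forall>x. f x = Some y \<longrightarrow> length x \<le> poly p (length y)"
      unfolding honest_def ..
    then have p: "length x \<le> poly p (length (F x))" for x
      unfolding A by (simp add: F)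
    obtain q :: "nat poly" where q: "\<And>x. length (F x) \<le> poly q (length x)"
    proof (rule poly_time_length_bound[OF time_f])
      fix p :: "nat poly"
      assume "\<And>x y. f x = Some y \<Longrightarrow> length y \<le> poly p (length x)"
      then show thesis
        by (intro that[of p]) (simp add: F)
    qed
    \<comment> \<open>Honesty of \<open>f\<close> bounds \<open>x\<close> through
      \<open>F x\<close>, and \<open>F x\<close> is bounded by \<open>q\<close> at the numeral
      length; \<open>[:1, 1:]\<close> adds the dropped leading 1.\<close>
    have "length x \<le> poly (pcompose p (pcompose q [:1, 1:])) (length (c (F x)))" for x
    proof -
      \<comment> \<open>The length of the full numeral of the rank of \<open>F x\<close>. The rank
        is therefore below \<open>2 ^ ?n\<close>, which is the number of strings in
        \<open>?L\<close>.\<close>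
      let ?n = "Suc (length (c (F x)))"
      let ?L = "{w :: bitstring. length w = ?n}"
      have "length (F x) \<le> poly q ?n"
      proof (rule ccontr)
        assume less: "\<not> length (F x) \<le> poly q ?n"
        have "F w \<le> F x" if "length w = ?n" for w
          using q[of w] less that by (simp add: less_imp_le less_if_length_less)
        then have "F ` ?L \<subseteq> {w \<in> ?A. w \<le> F x}"
          by (auto simp: A)
        then have "card (F ` ?L) \<le> rank (F x)"
          unfolding rank_def by (intro card_mono) auto
        moreover have "card (F ` ?L) = 2 ^ ?n"
          using card_lists_length_eq[of "UNIV :: bool set" ?n]
          by (simp add: card_image[OF inj_on_subset[OF inj subset_UNIV]])
        moreover have "rank (F x) < 2 ^ ?n"
          using less_power_length_binary[of "rank (F x)"] binary_rank[of "F x"] by (simp add: A)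
        ultimately show False
          by linarith
      qed
      then have "poly p (length (F x)) \<le> poly p (poly q ?n)"
        by (rule poly_nat_mono)
      with p[of x] show ?thesis
        by (simp add: poly_pcompose)
    qed
    then show ?thesis
      unfolding honest_def by (intro exI[of _ "pcompose p (pcompose q [:1, 1:])"] ballI allI impI) (auto simp: h_def)
  qed
  moreover have "\<not> FP_invertible h"
  proof
    assume "FP_invertible h"
    then obtain k where k: "poly_time k" "\<And>y. \<exists>x. k y = Some x \<and> h x = Some y"
      using \<open>ran h = UNIV\<close> unfolding FP_invertible_def by blast
    \<comment> \<open>To invert \<open>f\<close> at \<open>y\<close>, compress \<open>y\<close> and
      invert \<open>h\<close>; injectivity of \<open>c\<close> on \<open>?A\<close> turns
      \<open>c (F x) = c y\<close> into \<open>F x = y\<close>.\<close>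
    have "\<exists>x. (k \<circ>\<^sub>m (Some \<circ> c)) y = Some x \<and> f x = Some y" if y: "y \<in> ?A" for y
    proof -
      obtain x where x: "k (c y) = Some x" "c (F x) = c y"
        using k(2)[of "c y"] by (auto simp: h_def)
      have "F x = y"
        using inj_c[OF _ y x(2)] by (simp add: A)
      with x show ?thesis
        by (simp add: map_comp_def F)
    qed
    with poly_time_map_comp[OF time_c k(1)] have "FP_invertible f"
      unfolding FP_invertible_def by (intro exI[of _ "k \<circ>\<^sub>m (Some \<circ> c)"] conjI ballI)
    with f show False
      by (simp add: one_one_one_way_def)
  qed
  moreover have "dom h = UNIV"
    by (auto simp: h_def)
  ultimately have "one_way_permutation h"
    by (simp add: one_way_permutation_def one_one_one_way_def)
  then show ?thesis
    by blast
qed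

theorem theorem3:
  shows "(\<exists>f. one_way_permutation f) \<longleftrightarrow>
         (\<exists>f. one_one_one_way f \<and> dom f = UNIV \<and> P_rankable (ran f))"
proof
  assume "\<exists>f. one_way_permutation f"
  then obtain f where "dom f = UNIV" "ran f = UNIV" "one_one_one_way f"
    unfolding one_way_permutation_def by blast
  with P_rankable_UNIV show "\<exists>f. one_one_one_way f \<and> dom f = UNIV \<and> P_rankable (ran f)"
    by (intro exI[of _ f]) simp
next
  assume "\<exists>f. one_one_one_way f \<and> dom f = UNIV \<and> P_rankable (ran f)"
  then show "\<exists>f. one_way_permutation f"
    using one_way_permutation_if_rankable by (elim exE conjE)
qed

end
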